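(* Let $n\ge1$, let $\mathcal{K}$ be a regular incidence complex of rank $n$, let $\Gamma$ be a flag-transitive subgroup of $\Gamma(\mathcal{K})$, let $\Phi=\{F_{-1},F_0,\dots,F_n\}$ be a flag of $\mathcal{K}$ ($F_i$ of rank $i$), and let $R_i=\{\varphi\in\Gamma: F_j\varphi=F_j\text{ for all }j\ne i\}$ for $i=-1,\dots,n$. Then $\mathcal{K}$ is isomorphic to the complex $\mathcal{K}(\Gamma;R_{-1},R_0,\dots,R_n)$; in particular, the map $F_i\varphi\mapsto\Gamma_i\varphi$ ($-1\le i\le n$, $\varphi\in\Gamma$) is a well-defined isomorphism.
   Context: An incidence complex of rank $n$ is a poset with: (I1) a least face and a greatest face; (I2) every chain contained in a maximal chain (flag) with exactly $n+2$ elements (so there is a rank function with values $-1,\dots,n$); (I3) every section $G/F=\{H:F\le H\le G\}$ (including the poset) connected, where rank $\le1$ posets are connected and a rank $\ge2$ poset is connected if any two proper faces are joined by a finite sequence of proper faces with consecutive members comparable; (I4) for $i=0,\dots,n-1$, whenever $F<G$ with ranks $i-1,i+1$, at least two $i$-faces strictly between them. $\Gamma(\mathcal{K})$ is its automorphism group (order-preserving bijections with order-preserving inverse), acting on the right ($F\varphi$ = image of $F$); $\mathcal{K}$ is regular if $\Gamma(\mathcal{K})$ is flag-transitive; $\Gamma\le\Gamma(\mathcal{K})$ is flag-transitive if transitive on flags. Let $N=\{-1,\dots,n\}$; $\Gamma_I=\langle R_i:i\in I\rangle$ for nonempty $I\subseteq N$, $\Gamma_\emptyset=R_{-1}$, $\Gamma_i=\Gamma_{N\setminus\{i\}}$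 (so $\Gamma_{-1}=\Gamma_n=\Gamma$), $\Gamma_i^-=\Gamma_{\{-1,\dots,i\}}$, $\Gamma_i^+=\Gamma_{\{i,\dots,n\}}$. The poset $\mathcal{K}(\Gamma;R_{-1},\dots,R_n)$ has as $i$-faces ($0\le i\le n-1$) the right cosets $\Gamma_i\varphi$, $\varphi\in\Gamma$, plus two distinct improper faces $\Gamma_{-1}$ (rank $-1$) and $\Gamma_n$ (rank $n$), each a copy of $\Gamma$, with $\Gamma_{-1}\varphi=\Gamma_{-1}$ and $\Gamma_n\varphi=\Gamma_n$; the order is $\Gamma_i\varphi\le\Gamma_j\psi$ iff $i\le j$ and $\varphi\psi^{-1}\in\Gamma_{i+1}^+\Gamma_{j-1}^-$. *)

theory Defs
  imports "HOL-Algebra.Order" "HOL-Algebra.Lattice" "HOL-Algebra.Generated_Groups"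
begin

section \<open>Chains, flags and rank\<close>

definition poset_chain :: "('a, 'm) gorder_scheme \<Rightarrow> 'a set \<Rightarrow> bool" where
  "poset_chain K C \<longleftrightarrow> C \<subseteq> carrier K \<and> (\<forall>x\<in>C. \<forall>y\<in>C. x \<sqsubseteq>\<^bsub>K\<^esub> y \<or> y \<sqsubseteq>\<^bsub>K\<^esub> x)"

definition flag :: "('a, 'm) gorder_scheme \<Rightarrow> 'a set \<Rightarrow> bool" where
  "flag K \<Phi> \<longleftrightarrow> poset_chain K \<Phi> \<and> (\<forall>C. poset_chain K C \<and> \<Phi> \<subseteq> C \<longrightarrow> C = \<Phi>)"

text \<open>
  The rank of a face is its position in a flag containing it, counted from \<open>-1\<close>. Under (I1) and
  (I2) below the position does not depend on the flag; otherwise the description is arbitrary.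
\<close>

definition face_rank :: "('a, 'm) gorder_scheme \<Rightarrow> 'a \<Rightarrow> int" where
  "face_rank K F =
    (THE r. \<exists>\<Phi>. flag K \<Phi> \<and> F \<in> \<Phi> \<and> r = int (card {H \<in> \<Phi>. H \<sqsubset>\<^bsub>K\<^esub> F}) - 1)"

section \<open>Sections and connectedness\<close>

abbreviation poset_section :: "('a, 'm) gorder_scheme \<Rightarrow> 'a \<Rightarrow> 'a \<Rightarrow> ('a, 'm) gorder_scheme" where
  "poset_section K F G \<equiv> K\<lparr>carrier := {H \<in> carrier K. F \<sqsubseteq>\<^bsub>K\<^esub> H \<and> H \<sqsubseteq>\<^bsub>K\<^esub> G}\<rparr>"

definition proper_faces :: "('a, 'm) gorder_scheme \<Rightarrow> 'a set" where
  "proper_faces P =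
    {H \<in> carrier P. \<not> least P H (carrier P) \<and> \<not> greatest P H (carrier P)}"

text \<open>The second argument is the rank of the poset.\<close>

definition connected_poset :: "('a, 'm) gorder_scheme \<Rightarrow> int \<Rightarrow> bool" where
  "connected_poset P r \<longleftrightarrow> r \<le> 1 \<or>
    (\<forall>H\<in>proper_faces P. \<forall>H'\<in>proper_faces P.
      (H, H') \<in> {(x, y). x \<in> proper_faces P \<and> y \<in> proper_faces P \<and>
                          (x \<sqsubseteq>\<^bsub>P\<^esub> y \<or> y \<sqsubseteq>\<^bsub>P\<^esub> x)}\<^sup>*)"

section \<open>Incidence complexes\<close>

text \<open>
  (I3) speaks about all sections; the whole poset is the section between the least and the
  greatest face. The section between \<open>F\<close> and \<open>G\<close> has rank \<open>rank G - rank F - 1\<close>.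
\<close>

locale incidence_complex = partial_order K for n :: nat and K (structure) +
  assumes I1: "\<exists>x. least K x (carrier K)" "\<exists>x. greatest K x (carrier K)"
    and I2: "\<And>C. poset_chain K C \<Longrightarrow> \<exists>\<Phi>. flag K \<Phi> \<and> C \<subseteq> \<Phi> \<and> card \<Phi> = n + 2"
    and I3: "\<And>F G. \<lbrakk>F \<in> carrier K; G \<in> carrier K; F \<sqsubseteq> G\<rbrakk> \<Longrightarrow>
              connected_poset (poset_section K F G) (face_rank K G - face_rank K F - 1)"
    and I4: "\<And>i F G. \<lbrakk>0 \<le> i; i \<le> int n - 1; F \<in> carrier K; G \<in> carrier K; F \<sqsubset> G;
                       face_rank K F = i - 1; face_rank K G = i + 1\<rbrakk> \<Longrightarrow>
              \<exists>H H'. H \<noteq> H' \<and>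
                H \<in> carrier K \<and> face_rank K H = i \<and> F \<sqsubset> H \<and> H \<sqsubset> G \<and>
                H' \<in> carrier K \<and> face_rank K H' = i \<and> F \<sqsubset> H' \<and> H' \<sqsubset> G"

lemma (in incidence_complex) flag_card:
  assumes "flag K \<Phi>"
  shows "card \<Phi> = n + 2" "finite \<Phi>"
proof -
  obtain \<Psi> where \<Psi>: "flag K \<Psi>" "\<Phi> \<subseteq> \<Psi>" "card \<Psi> = n + 2"
    using I2 assms unfolding flag_def by blast
  then have "\<Psi> = \<Phi>"
    using assms unfolding flag_def by blast
  with \<Psi> show "card \<Phi> = n + 2" by simp
  then show "finite \<Phi>" by (metis card.infinite add_2_eq_Suc' nat.distinct(1))
qed

lemma (in incidence_complex) flag_splice:
  assumes "flag K \<Phi>" "flag K \<Psi>" "F \<in> \<Phi>" "F \<in> \<Psi>"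
  shows "flag K ({H \<in> \<Phi>. H \<sqsubset> F} \<union> {H \<in> \<Psi>. F \<sqsubseteq> H})"
proof -
  let ?C = "{H \<in> \<Phi>. H \<sqsubset> F} \<union> {H \<in> \<Psi>. F \<sqsubseteq> H}"
  have carr: "\<Phi> \<subseteq> carrier K" "\<Psi> \<subseteq> carrier K" and F: "F \<in> carrier K"
    using assms unfolding flag_def poset_chain_def by auto
  have cmp: "x \<sqsubseteq> y \<or> y \<sqsubseteq> x" if "x \<in> \<Phi> \<and> y \<in> \<Phi> \<or> x \<in> \<Psi> \<and> y \<in> \<Psi>" for x y
    using assms that unfolding flag_def poset_chain_def by blast
  have mixed: "x \<sqsubseteq> y" if "x \<in> \<Phi>" "x \<sqsubset> F" "y \<in> \<Psi>" "F \<sqsubseteq> y" for x y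
    using that carr F le_trans[of x F y] unfolding lless_def by blast
  have chain: "poset_chain K ?C"
    unfolding poset_chain_def using carr cmp mixed by blast
  have "x \<in> ?C" if D: "poset_chain K D" "?C \<subseteq> D" and x: "x \<in> D" for D x
  proof -
    have "F \<in> D" using D F assms by auto
    have xc: "x \<in> carrier K" and xcmp: "x \<sqsubseteq> y \<or> y \<sqsubseteq> x" if "y \<in> D" for y
      using D x that unfolding poset_chain_def by auto
    have xF: "x \<in> carrier K" "x \<sqsubset> F \<or> F \<sqsubseteq> x"
      using xc xcmp[OF \<open>F \<in> D\<close>] \<open>F \<in> D\<close> F by (auto simp: lless_def eq_is_equal)
    from xF(2) show ?thesis
    proof
      assume a: "x \<sqsubset> F"
      have "x \<sqsubseteq> y \<or> y \<sqsubseteq> x" if y: "y \<in> \<Phi>" for y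
      proof (cases "y \<sqsubset> F")
        case True
        with y D have "y \<in> D" by blast
        then show ?thesis by (rule xcmp)
      next
        case False
        with cmp[of y F] y assms have "F \<sqsubseteq> y" using F carr by (auto simp: lless_def eq_is_equal)
        then show ?thesis using a le_trans[of x F y] xF F y carr by (auto simp: lless_def)
      qed
      then have "poset_chain K (insert x \<Phi>)"
        using assms(1) xF(1) unfolding flag_def poset_chain_def by auto
      then have "x \<in> \<Phi>" using assms(1) unfolding flag_def by blast
      with a show ?thesis by simp
    next
      assume a: "F \<sqsubseteq> x"
      have "x \<sqsubseteq> y \<or> y \<sqsubseteq> x" if y: "y \<in> \<Psi>" for y
      proof (cases "F \<sqsubseteq> y")
        case True
        with y D have "y \<in> D" by blast
        then show ?thesis by (rule xcmp)
      next
        case False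
        with cmp[of y F] y assms have "y \<sqsubseteq> F" by blast
        then show ?thesis using a le_trans[of y F x] xF F y carr by auto
      qed
      then have "poset_chain K (insert x \<Psi>)"
        using assms(2) xF(1) unfolding flag_def poset_chain_def by auto
      then have "x \<in> \<Psi>" using assms(2) unfolding flag_def by blast
      with a show ?thesis by simp
    qed
  qed
  with chain show ?thesis unfolding flag_def by blast
qed

lemma (in incidence_complex) face_rank_eq:
  assumes "flag K \<Phi>" "F \<in> \<Phi>"
  shows "face_rank K F = int (card {H \<in> \<Phi>. H \<sqsubset> F}) - 1"
proof -
  have indep: "card {H \<in> \<Psi>. H \<sqsubset> F} = card {H \<in> \<Phi>. H \<sqsubset> F}" if \<Psi>: "flag K \<Psi>" "F \<in> \<Psi>" for \<Psi>
  proof -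
    have not_less: "\<not> H \<sqsubset> F" if "H \<in> \<Theta>" "flag K \<Theta>" "F \<in> \<Theta>" "F \<sqsubseteq> H" for H \<Theta>
    proof
      assume "H \<sqsubset> F"
      then have "H \<sqsubseteq> F" "H \<noteq> F"
        by (simp_all add: lless_def eq_is_equal)
      moreover have "H \<in> carrier K" "F \<in> carrier K"
        using that unfolding flag_def poset_chain_def by blast+
      ultimately show False
        using le_antisym \<open>F \<sqsubseteq> H\<close> by blast
    qed
    have split: "card ({H \<in> \<Theta>. H \<sqsubset> F} \<union> {H \<in> \<Phi>. F \<sqsubseteq> H})
        = card {H \<in> \<Theta>. H \<sqsubset> F} + card {H \<in> \<Phi>. F \<sqsubseteq> H}"
      if "flag K \<Theta>" "F \<in> \<Theta>" for \<Theta>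
    proof (rule card_Un_disjoint)
      show "finite {H \<in> \<Theta>. H \<sqsubset> F}" "finite {H \<in> \<Phi>. F \<sqsubseteq> H}"
        using flag_card(2)[OF that(1)] flag_card(2)[OF assms(1)] by simp_all
      show "{H \<in> \<Theta>. H \<sqsubset> F} \<inter> {H \<in> \<Phi>. F \<sqsubseteq> H} = {}"
        using not_less[OF _ assms] by blast
    qed
    show ?thesis
      using split[OF \<Psi>] split[OF assms] flag_card(1)[OF flag_splice[OF \<Psi>(1) assms(1) \<Psi>(2) assms(2)]]
        flag_card(1)[OF flag_splice[OF assms(1) assms(1) assms(2) assms(2)]] by simp
  qed
  show ?thesis
    unfolding face_rank_def
  proof (rule the_equality)
    show "r = int (card {H \<in> \<Phi>. H \<sqsubset> F}) - 1"
      if "\<exists>\<Psi>. flag K \<Psi> \<and> F \<in> \<Psi> \<and> r = int (card {H \<in> \<Psi>. H \<sqsubset> F}) - 1" for r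
      using that by (elim exE conjE) (simp only: indep)
  qed (use assms in blast)
qed

section \<open>Isomorphisms and automorphisms\<close>

definition poset_iso :: "('a, 'm) gorder_scheme \<Rightarrow> ('b, 'k) gorder_scheme \<Rightarrow> ('a \<Rightarrow> 'b) set" where
  "poset_iso K L = {f. bij_betw f (carrier K) (carrier L) \<and>
    (\<forall>x\<in>carrier K. \<forall>y\<in>carrier K. x \<sqsubseteq>\<^bsub>K\<^esub> y \<longleftrightarrow> f x \<sqsubseteq>\<^bsub>L\<^esub> f y)}"

text \<open>
  Automorphisms act on the right: the product \<open>\<phi> \<otimes> \<psi>\<close> applies \<open>\<phi>\<close> first, and \<open>\<phi> F\<close>
  stands for \<open>F\<phi>\<close>. This is opposite to the multiplication of \<open>BijGroup\<close>.
\<close>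

definition aut_group :: "('a, 'm) gorder_scheme \<Rightarrow> ('a \<Rightarrow> 'a) monoid" where
  "aut_group K =
    \<lparr>carrier = poset_iso K K \<inter> extensional (carrier K),
     monoid.mult = (\<lambda>\<phi> \<psi>. compose (carrier K) \<psi> \<phi>),
     one = (\<lambda>x\<in>carrier K. x)\<rparr>"

lemma group_aut_group: "group (aut_group K)"
proof (rule groupI)
  have order: "x \<sqsubseteq>\<^bsub>K\<^esub> y \<longleftrightarrow> \<phi> x \<sqsubseteq>\<^bsub>K\<^esub> \<phi> y"
    if "\<phi> \<in> carrier (aut_group K)" "x \<in> carrier K" "y \<in> carrier K" for \<phi> x y
    using that unfolding aut_group_def poset_iso_def by simp
  fix \<phi> \<psi> assume a: "\<phi> \<in> carrier (aut_group K)" "\<psi> \<in> carrier (aut_group K)"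
  then have b: "bij_betw (compose (carrier K) \<psi> \<phi>) (carrier K) (carrier K)"
    by (auto simp: aut_group_def poset_iso_def intro: bij_betw_compose)
  have m: "\<phi> x \<in> carrier K" if "x \<in> carrier K" for x
    using a that by (auto simp: aut_group_def poset_iso_def bij_betw_def)
  show "\<phi> \<otimes>\<^bsub>aut_group K\<^esub> \<psi> \<in> carrier (aut_group K)"
  proof -
    have "x \<sqsubseteq>\<^bsub>K\<^esub> y \<longleftrightarrow> \<psi> (\<phi> x) \<sqsubseteq>\<^bsub>K\<^esub> \<psi> (\<phi> y)" if "x \<in> carrier K" "y \<in> carrier K" for x y
      using order[OF a(1) that] order[OF a(2) m[OF that(1)] m[OF that(2)]] by blast
    with b show ?thesis
      by (simp add: aut_group_def poset_iso_def compose_eq)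
  qed
next
  show "\<one>\<^bsub>aut_group K\<^esub> \<in> carrier (aut_group K)"
    by (auto simp: aut_group_def poset_iso_def bij_betw_def inj_on_def)
next
  fix \<phi> \<psi> \<chi>
  assume a: "\<phi> \<in> carrier (aut_group K)" "\<psi> \<in> carrier (aut_group K)" "\<chi> \<in> carrier (aut_group K)"
  then have "\<phi> \<in> carrier K \<rightarrow> carrier K"
    by (auto simp: aut_group_def poset_iso_def bij_betw_def)
  then show "\<phi> \<otimes>\<^bsub>aut_group K\<^esub> \<psi> \<otimes>\<^bsub>aut_group K\<^esub> \<chi> = \<phi> \<otimes>\<^bsub>aut_group K\<^esub> (\<psi> \<otimes>\<^bsub>aut_group K\<^esub> \<chi>)"
    by (auto simp: aut_group_def compose_def fun_eq_iff)
next
  fix \<phi> assume a: "\<phi> \<in> carrier (aut_group K)"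
  then show "\<one>\<^bsub>aut_group K\<^esub> \<otimes>\<^bsub>aut_group K\<^esub> \<phi> = \<phi>"
    by (auto simp: aut_group_def compose_def extensional_def fun_eq_iff)
  let ?g = "restrict (inv_into (carrier K) \<phi>) (carrier K)"
  have b: "bij_betw \<phi> (carrier K) (carrier K)"
    using a by (simp add: aut_group_def poset_iso_def)
  have g: "bij_betw ?g (carrier K) (carrier K)"
    using bij_betw_inv_into[OF b] by (simp add: bij_betw_def)
  have gx: "?g x \<in> carrier K" "\<phi> (?g x) = x" if "x \<in> carrier K" for x
    using that b g by (auto simp: bij_betw_inv_into_right inv_into_into bij_betw_def f_inv_into_f)
  have "x \<sqsubseteq>\<^bsub>K\<^esub> y \<longleftrightarrow> ?g x \<sqsubseteq>\<^bsub>K\<^esub> ?g y" if "x \<in> carrier K" "y \<in> carrier K" for x y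
  proof -
    have "\<forall>x\<in>carrier K. \<forall>y\<in>carrier K. x \<sqsubseteq>\<^bsub>K\<^esub> y \<longleftrightarrow> \<phi> x \<sqsubseteq>\<^bsub>K\<^esub> \<phi> y"
      using a by (simp add: aut_group_def poset_iso_def)
    from this[rule_format, OF gx(1)[OF that(1)] gx(1)[OF that(2)]] show ?thesis
      unfolding gx(2)[OF that(1)] gx(2)[OF that(2)] by simp
  qed
  with g have "?g \<in> carrier (aut_group K)"
    by (simp only: aut_group_def poset_iso_def) simp
  moreover have "?g \<otimes>\<^bsub>aut_group K\<^esub> \<phi> = \<one>\<^bsub>aut_group K\<^esub>"
    using gx by (auto simp: aut_group_def compose_def fun_eq_iff)
  ultimately show "\<exists>\<psi>\<in>carrier (aut_group K). \<psi> \<otimes>\<^bsub>aut_group K\<^esub> \<phi> = \<one>\<^bsub>aut_group K\<^esub>"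
    by blast
qed

definition flag_transitive :: "('a \<Rightarrow> 'a) set \<Rightarrow> ('a, 'm) gorder_scheme \<Rightarrow> bool" where
  "flag_transitive \<Gamma> K \<longleftrightarrow> (\<forall>\<Phi> \<Psi>. flag K \<Phi> \<and> flag K \<Psi> \<longrightarrow> (\<exists>\<phi>\<in>\<Gamma>. \<phi> ` \<Phi> = \<Psi>))"

locale regular_incidence_complex = incidence_complex n K for n :: nat and K (structure) +
  assumes flag_transitive_aut: "flag_transitive (carrier (aut_group K)) K"

section \<open>The complex of cosets\<close>

text \<open>
  \<open>G\<close> is a group and \<open>R\<close> a family of subgroups indexed by \<open>{-1..int n}\<close>.
\<close>

definition gen_subgroup :: "('g, 'm) monoid_scheme \<Rightarrow> (int \<Rightarrow> 'g set) \<Rightarrow> int set \<Rightarrow> 'g set" where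
  "gen_subgroup G R I = (if I = {} then R (-1) else generate G (\<Union>i\<in>I. R i))"

abbreviation gen_minus :: "('g, 'm) monoid_scheme \<Rightarrow> (int \<Rightarrow> 'g set) \<Rightarrow> int \<Rightarrow> 'g set" where
  "gen_minus G R i \<equiv> gen_subgroup G R {-1..i}"

abbreviation gen_plus ::
  "nat \<Rightarrow> ('g, 'm) monoid_scheme \<Rightarrow> (int \<Rightarrow> 'g set) \<Rightarrow> int \<Rightarrow> 'g set" where
  "gen_plus n G R i \<equiv> gen_subgroup G R {i..int n}"

text \<open>
  The face \<open>\<Gamma>\<^sub>i\<phi>\<close>. Faces carry their rank, so that the two improper faces, both copies of the
  whole group, are distinct from each other and from all cosets.
\<close>

definition coset_face ::
  "nat \<Rightarrow> ('g, 'm) monoid_scheme \<Rightarrow> (int \<Rightarrow> 'g set) \<Rightarrow> int \<Rightarrow> 'g \<Rightarrow> int \<times> 'g set" where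
  "coset_face n G R i \<phi> =
    (i, if 0 \<le> i \<and> i \<le> int n - 1 then gen_subgroup G R ({-1..int n} - {i}) #>\<^bsub>G\<^esub> \<phi>
        else carrier G)"

definition coset_le ::
  "nat \<Rightarrow> ('g, 'm) monoid_scheme \<Rightarrow> (int \<Rightarrow> 'g set) \<Rightarrow> int \<Rightarrow> 'g \<Rightarrow> int \<Rightarrow> 'g \<Rightarrow> bool" where
  "coset_le n G R i \<phi> j \<psi> \<longleftrightarrow>
    i \<le> j \<and> \<phi> \<otimes>\<^bsub>G\<^esub> inv\<^bsub>G\<^esub> \<psi> \<in> gen_plus n G R (i + 1) <#>\<^bsub>G\<^esub> gen_minus G R (j - 1)"

text \<open>
  The order between two faces is declared through \<open>coset_le\<close> for some choice of ranks and
  representatives; that every choice gives the same answer is a theorem about suitable \<open>G\<close>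
  and \<open>R\<close>.
\<close>

definition coset_complex ::
  "nat \<Rightarrow> ('g, 'm) monoid_scheme \<Rightarrow> (int \<Rightarrow> 'g set) \<Rightarrow> (int \<times> 'g set) gorder" where
  "coset_complex n G R =
    \<lparr>carrier = {coset_face n G R i \<phi> | i \<phi>. i \<in> {-1..int n} \<and> \<phi> \<in> carrier G},
     eq = (=),
     le = (\<lambda>X Y. \<exists>i\<in>{-1..int n}. \<exists>j\<in>{-1..int n}. \<exists>\<phi>\<in>carrier G. \<exists>\<psi>\<in>carrier G.
            X = coset_face n G R i \<phi> \<and> Y = coset_face n G R j \<psi> \<and> coset_le n G R i \<phi> j \<psi>)\<rparr>"

end

theory Submission
  imports Defs
begin

text \<open>
  By connectedness of sections, the pointwise stabilizer in \<open>\<Gamma>\<close> of the part of the base flag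
  lying outside an open interval of ranks is generated by the \<open>R\<^sub>i\<close> with \<open>i\<close> in that interval.
  If \<open>F\<^sub>i\<tau> \<le> F\<^sub>j\<close>, a flag through \<open>F\<^sub>k\<tau>\<close> (\<open>k \<le> i\<close>) and \<open>F\<^sub>k\<close> (\<open>k \<ge> j\<close>) is the image of the base
  flag under some \<open>\<sigma> \<in> \<Gamma>\<close>; then \<open>\<tau> = (\<tau>\<sigma>\<^sup>-\<^sup>1)\<sigma>\<close> is the factorization required by the coset order.
  The case \<open>i = j\<close> identifies the stabilizer of \<open>F\<^sub>i\<close> with \<open>\<Gamma>\<^sub>i\<close>.
\<close>

section \<open>Automorphisms acting on chains and flags\<close>

lemma aut_group_carrierD:
  assumes "\<phi> \<in> carrier (aut_group K)"
  shows "bij_betw \<phi> (carrier K) (carrier K)"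
    and "\<And>x. x \<in> carrier K \<Longrightarrow> \<phi> x \<in> carrier K"
    and "\<And>x y. x \<in> carrier K \<Longrightarrow> y \<in> carrier K \<Longrightarrow> \<phi> x \<sqsubseteq>\<^bsub>K\<^esub> \<phi> y \<longleftrightarrow> x \<sqsubseteq>\<^bsub>K\<^esub> y"
  using assms by (auto simp: aut_group_def poset_iso_def bij_betw_def)

lemma poset_chain_subset: "poset_chain K C \<Longrightarrow> D \<subseteq> C \<Longrightarrow> poset_chain K D"
  unfolding poset_chain_def by (meson subset_iff)

lemma poset_chain_Un:
  assumes "poset_chain K C" "poset_chain K D" "\<And>x y. x \<in> C \<Longrightarrow> y \<in> D \<Longrightarrow> x \<sqsubseteq>\<^bsub>K\<^esub> y"
  shows "poset_chain K (C \<union> D)"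
  using assms unfolding poset_chain_def by auto

context incidence_complex
begin

lemma lless_iff: "x \<sqsubset> y \<longleftrightarrow> x \<sqsubseteq> y \<and> x \<noteq> y"
  by (simp add: lless_def eq_is_equal)

lemma poset_chain_aut_image:
  assumes "\<phi> \<in> carrier (aut_group K)" "poset_chain K C"
  shows "poset_chain K (\<phi> ` C)"
  using assms aut_group_carrierD[OF assms(1)] unfolding poset_chain_def
  by (auto simp: subset_iff)

text \<open>Maximality is pulled back: the inverse maps a chain that contains the image of \<Phi> to
  a chain that contains \<Phi>, which must be \<Phi> itself.\<close>

lemma flag_aut_image:
  assumes \<phi>: "\<phi> \<in> carrier (aut_group K)" and "flag K \<Phi>"
  shows "flag K (\<phi> ` \<Phi>)"
proof -
  interpret A: group "aut_group K" by (rule group_aut_group)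
  let ?\<psi> = "inv\<^bsub>aut_group K\<^esub> \<phi>"
  have \<psi>: "?\<psi> \<in> carrier (aut_group K)" using \<phi> by simp
  have "?\<psi> \<otimes>\<^bsub>aut_group K\<^esub> \<phi> = \<one>\<^bsub>aut_group K\<^esub>" "\<phi> \<otimes>\<^bsub>aut_group K\<^esub> ?\<psi> = \<one>\<^bsub>aut_group K\<^esub>"
    using \<phi> by simp_all
  then have inv: "\<phi> (?\<psi> x) = x" "?\<psi> (\<phi> x) = x" if "x \<in> carrier K" for x
    using that by (auto simp: aut_group_def compose_def fun_eq_iff split: if_splits dest: spec[of _ x])
  have chain: "poset_chain K (\<phi> ` \<Phi>)"
    using assms poset_chain_aut_image unfolding flag_def by blast
  have "C = \<phi> ` \<Phi>" if C: "poset_chain K C" "\<phi> ` \<Phi> \<subseteq> C" for C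
  proof -
    have car: "\<Phi> \<subseteq> carrier K" "C \<subseteq> carrier K"
      using assms C unfolding flag_def poset_chain_def by auto
    have "\<Phi> \<subseteq> ?\<psi> ` C"
    proof
      fix x assume "x \<in> \<Phi>"
      then have "\<phi> x \<in> C" "x = ?\<psi> (\<phi> x)" using C car inv(2)[of x] by auto
      then show "x \<in> ?\<psi> ` C" by blast
    qed
    then have "?\<psi> ` C = \<Phi>"
      using poset_chain_aut_image[OF \<psi> C(1)] assms unfolding flag_def by blast
    then have "\<phi> ` \<Phi> = (\<lambda>x. \<phi> (?\<psi> x)) ` C" by (auto simp: image_image)
    also have "\<dots> = id ` C" using inv(1) car by (intro image_cong) auto
    finally show ?thesis by simp
  qed
  with chain show ?thesis unfolding flag_def by blast
qed

lemma ex_flag: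
  assumes "poset_chain K C" obtains \<Phi> where "flag K \<Phi>" "C \<subseteq> \<Phi>"
  using I2[OF assms] by blast

lemma ex_flag_mem:
  assumes "x \<in> carrier K" obtains \<Phi> where "flag K \<Phi>" "x \<in> \<Phi>"
  using ex_flag[of "{x}"] assms unfolding poset_chain_def by auto

section \<open>Ranks of faces\<close>

text \<open>An automorphism carries the faces below \<open>x\<close> in a flag bijectively to the
  faces below \<open>\<phi> x\<close> in the image flag, and rank counts these in any flag.\<close>

lemma face_rank_aut:
  assumes \<phi>: "\<phi> \<in> carrier (aut_group K)" and x: "x \<in> carrier K"
  shows "face_rank K (\<phi> x) = face_rank K x"
proof -
  obtain \<Phi> where \<Phi>: "flag K \<Phi>" "x \<in> \<Phi>" using ex_flag_mem x .
  then have car: "\<Phi> \<subseteq> carrier K" unfolding flag_def poset_chain_def by auto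
  have inj: "inj_on \<phi> (carrier K)"
    using aut_group_carrierD(1)[OF \<phi>] by (simp add: bij_betw_def)
  have "{H \<in> \<phi> ` \<Phi>. H \<sqsubset> \<phi> x} = \<phi> ` {H \<in> \<Phi>. H \<sqsubset> x}"
    using aut_group_carrierD(3)[OF \<phi>] car x inj by (auto simp: lless_iff inj_on_def subset_iff)
  moreover have "card (\<phi> ` {H \<in> \<Phi>. H \<sqsubset> x}) = card {H \<in> \<Phi>. H \<sqsubset> x}"
    by (rule card_image) (use car inj in \<open>auto intro: inj_on_subset\<close>)
  ultimately show ?thesis
    using face_rank_eq[OF \<Phi>] face_rank_eq[OF flag_aut_image[OF \<phi> \<Phi>(1)] imageI[OF \<Phi>(2)]] by simp
qed

text \<open>In a flag through both faces, everything below \<open>x\<close> is below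
  \<open>y\<close>, and \<open>x\<close> itself is counted for \<open>y\<close> only.\<close>

lemma face_rank_strict_mono:
  assumes "x \<in> carrier K" "y \<in> carrier K" "x \<sqsubset> y"
  shows "face_rank K x < face_rank K y"
proof -
  have "poset_chain K {x, y}" using assms unfolding poset_chain_def by (auto simp: lless_iff)
  then obtain \<Phi> where \<Phi>: "flag K \<Phi>" "{x, y} \<subseteq> \<Phi>" by (rule ex_flag)
  have car: "\<Phi> \<subseteq> carrier K" using \<Phi> unfolding flag_def poset_chain_def by auto
  have "{H \<in> \<Phi>. H \<sqsubset> x} \<subset> {H \<in> \<Phi>. H \<sqsubset> y}"
  proof
    show "{H \<in> \<Phi>. H \<sqsubset> x} \<subseteq> {H \<in> \<Phi>. H \<sqsubset> y}"
      using assms car le_trans[of _ x y] le_antisym[of x y] by (auto simp: lless_iff)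
    show "{H \<in> \<Phi>. H \<sqsubset> x} \<noteq> {H \<in> \<Phi>. H \<sqsubset> y}" using assms \<Phi> by (auto simp: lless_iff)
  qed
  then have "card {H \<in> \<Phi>. H \<sqsubset> x} < card {H \<in> \<Phi>. H \<sqsubset> y}"
    using flag_card(2)[OF \<Phi>(1)] by (intro psubset_card_mono) auto
  then show ?thesis using face_rank_eq[of \<Phi>] \<Phi> by auto
qed

lemma face_rank_mono:
  assumes "x \<in> carrier K" "y \<in> carrier K" "x \<sqsubseteq> y"
  shows "face_rank K x \<le> face_rank K y"
  using face_rank_strict_mono[OF assms(1,2)] assms(3) by (cases "x = y") (auto simp: lless_iff)

section \<open>Sections and their connectedness\<close>

lemma proper_faces_section:
  assumes "A \<in> carrier K" "B \<in> carrier K" "A \<sqsubseteq> B"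
  shows "proper_faces (poset_section K A B) = {H \<in> carrier K. A \<sqsubset> H \<and> H \<sqsubset> B}"
proof -
  have "least (poset_section K A B) H {H \<in> carrier K. A \<sqsubseteq> H \<and> H \<sqsubseteq> B} \<longleftrightarrow> H = A" for H
    using assms le_antisym unfolding least_def by (auto simp: Upper_def)
  moreover have "greatest (poset_section K A B) H {H \<in> carrier K. A \<sqsubseteq> H \<and> H \<sqsubseteq> B} \<longleftrightarrow> H = B" for H
    using assms le_antisym unfolding greatest_def by (auto simp: Lower_def)
  ultimately show ?thesis
    unfolding proper_faces_def by (auto simp: lless_iff)
qed

text \<open>(I3) as induction along a path. A rank difference of at least 3 means that the section
  has rank at least 2, which is where connectedness has content.\<close>

lemma section_connected_induct [consumes 7, case_names base step]:
  assumes "A \<in> carrier K" "B \<in> carrier K" "A \<sqsubseteq> B" "face_rank K B - face_rank K A \<ge> 3"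
    and "H \<in> carrier K" "A \<sqsubset> H \<and> H \<sqsubset> B" "H' \<in> carrier K \<and> A \<sqsubset> H' \<and> H' \<sqsubset> B"
    and base: "P H"
    and step: "\<And>x y. \<lbrakk>x \<in> carrier K; A \<sqsubset> x; x \<sqsubset> B; y \<in> carrier K; A \<sqsubset> y; y \<sqsubset> B;
                  x \<sqsubseteq> y \<or> y \<sqsubseteq> x; P x\<rbrakk> \<Longrightarrow> P y"
  shows "P H'"
proof -
  let ?S = "{H \<in> carrier K. A \<sqsubset> H \<and> H \<sqsubset> B}"
  have "(H, H') \<in> {(x, y). x \<in> ?S \<and> y \<in> ?S \<and> (x \<sqsubseteq> y \<or> y \<sqsubseteq> x)}\<^sup>*"
    using I3[OF assms(1-3)] assms(4-7) unfolding connected_poset_def proper_faces_section[OF assms(1-3)]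
    by auto
  then show ?thesis
    by (induction rule: rtrancl_induct) (use base step in auto)
qed

end

section \<open>The group action and the base flag\<close>

locale flag_transitive_complex = incidence_complex n K for n :: nat and K (structure) +
  fixes \<Gamma> :: "('a \<Rightarrow> 'a) set" and F :: "int \<Rightarrow> 'a"
  assumes subgroup_\<Gamma>: "subgroup \<Gamma> (aut_group K)"
    and transitive: "flag_transitive \<Gamma> K"
    and base_flag: "flag K (F ` {-1..int n})"
    and rank_F: "\<And>i. i \<in> {-1..int n} \<Longrightarrow> face_rank K (F i) = i"
begin

abbreviation G where "G \<equiv> (aut_group K)\<lparr>carrier := \<Gamma>\<rparr>"

abbreviation R where "R \<equiv> (\<lambda>i. {\<phi> \<in> \<Gamma>. \<forall>j\<in>{-1..int n}. j \<noteq> i \<longrightarrow> \<phi> (F j) = F j})"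

text \<open>The index set names the ranks whose base faces may move: \<open>R i\<close> is
  \<open>fixer {i}\<close>, and \<open>fixer {}\<close> is the stabilizer of the base flag.\<close>

definition fixer :: "int set \<Rightarrow> ('a \<Rightarrow> 'a) set" where
  "fixer I = {\<phi> \<in> \<Gamma>. \<forall>k\<in>{-1..int n} - I. \<phi> (F k) = F k}"

sublocale G: group G
  by (rule subgroup.subgroup_is_group[OF subgroup_\<Gamma> group_aut_group])

lemma \<Gamma>_aut: "\<phi> \<in> \<Gamma> \<Longrightarrow> \<phi> \<in> carrier (aut_group K)"
  using subgroup.subset[OF subgroup_\<Gamma>] by blast

lemmas \<Gamma>D = aut_group_carrierD(2,3)[OF \<Gamma>_aut]

lemma mult_closed: "\<phi> \<in> \<Gamma> \<Longrightarrow> \<psi> \<in> \<Gamma> \<Longrightarrow> \<phi> \<otimes>\<^bsub>G\<^esub> \<psi> \<in> \<Gamma>"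
  using G.m_closed by simp

lemma inv_closed: "\<phi> \<in> \<Gamma> \<Longrightarrow> inv\<^bsub>G\<^esub> \<phi> \<in> \<Gamma>"
  using G.inv_closed by simp

lemma mult_apply: "x \<in> carrier K \<Longrightarrow> (\<phi> \<otimes>\<^bsub>G\<^esub> \<psi>) x = \<psi> (\<phi> x)"
  by (simp add: aut_group_def compose_eq)

lemma one_apply: "x \<in> carrier K \<Longrightarrow> \<one>\<^bsub>G\<^esub> x = x"
  by (simp add: aut_group_def)

lemma inv_apply:
  assumes "\<phi> \<in> \<Gamma>" "x \<in> carrier K"
  shows "(inv\<^bsub>G\<^esub> \<phi>) (\<phi> x) = x" "\<phi> ((inv\<^bsub>G\<^esub> \<phi>) x) = x"
proof -
  have "\<phi> \<otimes>\<^bsub>G\<^esub> inv\<^bsub>G\<^esub> \<phi> = \<one>\<^bsub>G\<^esub>" "inv\<^bsub>G\<^esub> \<phi> \<otimes>\<^bsub>G\<^esub> \<phi> = \<one>\<^bsub>G\<^esub>"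
    using assms(1) G.r_inv[of \<phi>] G.l_inv[of \<phi>] by simp_all
  then show "(inv\<^bsub>G\<^esub> \<phi>) (\<phi> x) = x" "\<phi> ((inv\<^bsub>G\<^esub> \<phi>) x) = x"
    using mult_apply[OF assms(2)] one_apply[OF assms(2)] by metis+
qed

lemma mult_inv_cancel:
  assumes "\<phi> \<in> \<Gamma>" "\<psi> \<in> \<Gamma>" shows "(\<phi> \<otimes>\<^bsub>G\<^esub> inv\<^bsub>G\<^esub> \<psi>) \<otimes>\<^bsub>G\<^esub> \<psi> = \<phi>"
  using assms G.m_assoc[of \<phi> "inv\<^bsub>G\<^esub> \<psi>" \<psi>] G.l_inv[of \<psi>] G.r_one[of \<phi>] inv_closed by simp

lemma F_carrier: "i \<in> {-1..int n} \<Longrightarrow> F i \<in> carrier K"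
  using base_flag unfolding flag_def poset_chain_def by auto

lemma F_mono:
  assumes "i \<in> {-1..int n}" "j \<in> {-1..int n}" "i \<le> j"
  shows "F i \<sqsubseteq> F j"
proof -
  have "F i \<sqsubseteq> F j \<or> F j \<sqsubseteq> F i"
    using base_flag assms unfolding flag_def poset_chain_def by blast
  then show ?thesis
    using face_rank_mono[of "F j" "F i"] rank_F F_carrier assms
    by (metis le_antisym le_refl order_antisym)
qed

lemma F_strict_mono:
  assumes "i \<in> {-1..int n}" "j \<in> {-1..int n}" "i < j"
  shows "F i \<sqsubset> F j"
  using F_mono[of i j] rank_F[of i] rank_F[of j] assms by (auto simp: lless_iff)

lemma rank_image: "i \<in> {-1..int n} \<Longrightarrow> \<phi> \<in> \<Gamma> \<Longrightarrow> face_rank K (\<phi> (F i)) = i"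
  using face_rank_aut[OF \<Gamma>_aut] F_carrier rank_F by simp

section \<open>Faces as images of base faces\<close>

text \<open>A flag through the chain is the image of the base flag under one \<sigma>, which serves
  the whole chain. Since \<sigma> preserves rank, the preimage of \<open>x\<close> in the base flag
  is the base face of the same rank.\<close>

lemma ex_rep_chain:
  assumes "poset_chain K C"
  obtains \<sigma> where "\<sigma> \<in> \<Gamma>"
    "\<forall>x\<in>C. face_rank K x \<in> {-1..int n} \<and> \<sigma> (F (face_rank K x)) = x"
proof -
  obtain \<Phi> where \<Phi>: "flag K \<Phi>" "C \<subseteq> \<Phi>" using assms by (rule ex_flag)
  then obtain \<sigma> where \<sigma>: "\<sigma> \<in> \<Gamma>" "\<sigma> ` (F ` {-1..int n}) = \<Phi>"
    using transitive base_flag unfolding flag_transitive_def by blast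
  have "face_rank K x \<in> {-1..int n} \<and> \<sigma> (F (face_rank K x)) = x" if "x \<in> C" for x
  proof -
    have "x \<in> \<sigma> ` (F ` {-1..int n})" using that \<Phi> \<sigma> by blast
    then obtain k where "k \<in> {-1..int n}" "x = \<sigma> (F k)" by blast
    then show ?thesis using rank_image[of k \<sigma>] \<sigma> by auto
  qed
  with \<sigma> that show thesis by blast
qed

lemma ex_rep:
  assumes "x \<in> carrier K"
  obtains \<sigma> where "\<sigma> \<in> \<Gamma>" "face_rank K x \<in> {-1..int n}" "\<sigma> (F (face_rank K x)) = x"
  using ex_rep_chain[of "{x}"] assms unfolding poset_chain_def by auto

text \<open>The least face lies below \<open>F (-1)\<close>, so it has the smallest possible rank
  \<open>-1\<close>; strict monotonicity of rank then forbids it to differ from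
  \<open>F (-1)\<close>.\<close>

lemma F_least:
  assumes x: "x \<in> carrier K" shows "F (-1) \<sqsubseteq> x"
proof -
  obtain b where b: "least K b (carrier K)" using I1(1) by blast
  then have bc: "b \<in> carrier K" by (auto simp: least_def)
  then have le: "b \<sqsubseteq> y" if "y \<in> carrier K" for y using b that by (auto simp: least_def)
  obtain \<sigma> where \<sigma>: "\<sigma> \<in> \<Gamma>" "face_rank K b \<in> {-1..int n}" "\<sigma> (F (face_rank K b)) = b"
    using ex_rep[OF bc] .
  have "face_rank K b \<le> -1"
    using face_rank_mono[OF bc F_carrier[of "-1"] le] rank_F[of "-1"] F_carrier[of "-1"] by simp
  then have "face_rank K b = -1" using \<sigma>(2) by simp
  then have "b = F (-1)"
    using face_rank_strict_mono[OF bc F_carrier[of "-1"]] le[OF F_carrier[of "-1"]] rank_F[of "-1"]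
    by (auto simp: lless_iff)
  then show ?thesis using le x by simp
qed

lemma F_greatest:
  assumes x: "x \<in> carrier K" shows "x \<sqsubseteq> F (int n)"
proof -
  obtain b where b: "greatest K b (carrier K)" using I1(2) by blast
  then have bc: "b \<in> carrier K" by (auto simp: greatest_def)
  then have le: "y \<sqsubseteq> b" if "y \<in> carrier K" for y using b that by (auto simp: greatest_def)
  obtain \<sigma> where \<sigma>: "\<sigma> \<in> \<Gamma>" "face_rank K b \<in> {-1..int n}" "\<sigma> (F (face_rank K b)) = b"
    using ex_rep[OF bc] .
  have "face_rank K b \<ge> int n"
    using face_rank_mono[OF F_carrier[of "int n"] bc le] rank_F[of "int n"] F_carrier[of "int n"] by simp
  then have "face_rank K b = int n" using \<sigma>(2) by simp
  then have "b = F (int n)"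
    using face_rank_strict_mono[OF F_carrier[of "int n"] bc] le[OF F_carrier[of "int n"]] rank_F[of "int n"]
    by (auto simp: lless_iff)
  then show ?thesis using le x by simp
qed

text \<open>The image of an improper face is comparable to it and has the same rank, so it cannot
  differ from it.\<close>

lemma improper_fixed:
  assumes "\<phi> \<in> \<Gamma>" shows "\<phi> (F (-1)) = F (-1)" "\<phi> (F (int n)) = F (int n)"
proof -
  have "face_rank K (\<phi> (F (-1))) = face_rank K (F (-1))"
    "face_rank K (\<phi> (F (int n))) = face_rank K (F (int n))"
    using face_rank_aut[OF \<Gamma>_aut[OF assms]] F_carrier by auto
  moreover have "F (-1) \<in> carrier K" "F (int n) \<in> carrier K" using F_carrier by auto
  moreover have "\<phi> (F (-1)) \<in> carrier K" "\<phi> (F (int n)) \<in> carrier K"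
    using calculation \<Gamma>D(1)[OF assms] by auto
  ultimately show "\<phi> (F (-1)) = F (-1)" "\<phi> (F (int n)) = F (int n)"
    using F_least F_greatest face_rank_strict_mono less_irrefl unfolding lless_iff by metis+
qed

section \<open>Fixers and generated subgroups\<close>

lemma fixerD: "\<phi> \<in> fixer I \<Longrightarrow> k \<in> {-1..int n} \<Longrightarrow> k \<notin> I \<Longrightarrow> \<phi> (F k) = F k"
  and fixer_\<Gamma>: "\<phi> \<in> fixer I \<Longrightarrow> \<phi> \<in> \<Gamma>"
  unfolding fixer_def by auto

lemma inv_fixes: "\<phi> \<in> \<Gamma> \<Longrightarrow> x \<in> carrier K \<Longrightarrow> \<phi> x = x \<Longrightarrow> (inv\<^bsub>G\<^esub> \<phi>) x = x"
  using inv_apply(1)[of \<phi> x] by simp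

lemma subgroup_fixer: "subgroup (fixer I) G"
proof (rule G.subgroupI)
  have "\<one>\<^bsub>G\<^esub> \<in> fixer I"
    using G.one_closed one_apply[OF F_carrier] unfolding fixer_def by simp
  then show "fixer I \<noteq> {}" by blast
  show "fixer I \<subseteq> carrier G" by (auto simp: fixer_def)
  show "inv\<^bsub>G\<^esub> \<phi> \<in> fixer I" if "\<phi> \<in> fixer I" for \<phi>
    using that inv_closed inv_fixes[OF _ F_carrier] unfolding fixer_def by auto
  show "\<phi> \<otimes>\<^bsub>G\<^esub> \<psi> \<in> fixer I" if "\<phi> \<in> fixer I" "\<psi> \<in> fixer I" for \<phi> \<psi>
    using that mult_closed mult_apply[OF F_carrier] unfolding fixer_def by auto
qed

lemma gen_subgroup_subgroup: "subgroup (gen_subgroup G R I) G"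
proof (cases "I = {}")
  case True
  have "R (-1) = fixer {-1}" by (auto simp: fixer_def)
  then show ?thesis using True subgroup_fixer by (simp add: gen_subgroup_def)
next
  case False
  have "(\<Union>i\<in>I. R i) \<subseteq> carrier G" by auto
  from G.generate_is_subgroup[OF this] False show ?thesis by (simp add: gen_subgroup_def)
qed

lemma R_gen: "i \<in> I \<Longrightarrow> R i \<subseteq> gen_subgroup G R I"
  unfolding gen_subgroup_def by (auto intro: generate.incl)

text \<open>The stabilizer of the base flag lies in every \<open>R i\<close>; for empty
  \<open>I\<close> the convention \<open>R (-1)\<close> is one of these.\<close>

lemma fixer_empty_gen: "fixer {} \<subseteq> gen_subgroup G R I"
proof (cases "I = {}")
  case False
  then obtain i where "i \<in> I" by blast
  with R_gen[OF this] show ?thesis by (auto simp: fixer_def)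
qed (auto simp: gen_subgroup_def fixer_def)

text \<open>For empty \<open>I\<close> monotonicity of generation does not apply, since
  \<open>J\<close> need not contain \<open>-1\<close>. But \<open>R (-1)\<close> fixes the whole
  base flag, because all of \<Gamma> fixes \<open>F (-1)\<close>.\<close>

lemma gen_mono:
  assumes "I \<subseteq> J" shows "gen_subgroup G R I \<subseteq> gen_subgroup G R J"
proof (cases "I = {}")
  case True
  have "R (-1) \<subseteq> fixer {}"
    using improper_fixed(1) by (auto simp: fixer_def)
  with True fixer_empty_gen[of J] show ?thesis by (auto simp: gen_subgroup_def)
next
  case False
  have "(\<Union>i\<in>I. R i) \<subseteq> (\<Union>i\<in>J. R i)" using assms by (rule UN_mono) simp
  from G.mono_generate[OF this] False assms show ?thesis by (auto simp: gen_subgroup_def)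
qed

text \<open>The easy inclusion: a generator in \<open>R i\<close> moves at most the base face of
  rank \<open>i\<close>. The converse is proved below for intervals of ranks.\<close>

lemma gen_fixer: "gen_subgroup G R I \<subseteq> fixer I"
proof (cases "I = {}")
  case True
  then show ?thesis using improper_fixed(1) by (auto simp: gen_subgroup_def fixer_def)
next
  case False
  have "(\<Union>i\<in>I. R i) \<subseteq> fixer I" by (auto simp: fixer_def)
  from G.generate_subgroup_incl[OF this subgroup_fixer] False show ?thesis
    by (simp add: gen_subgroup_def)
qed

lemma gen_mult:
  "\<phi> \<in> gen_subgroup G R I \<Longrightarrow> \<psi> \<in> gen_subgroup G R I \<Longrightarrow> \<phi> \<otimes>\<^bsub>G\<^esub> \<psi> \<in> gen_subgroup G R I"
  using subgroup.m_closed[OF gen_subgroup_subgroup] .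

lemma chain_F:
  assumes "I \<subseteq> {-1..int n}" shows "poset_chain K (F ` I)"
  by (rule poset_chain_subset[OF _ image_mono[OF assms]]) (use base_flag in \<open>simp add: flag_def\<close>)

section \<open>Generation of the fixers of intervals\<close>

text \<open>The base faces up to rank \<open>a\<close>, then \<open>H\<close>, then the base faces
  from rank \<open>b\<close> on form a chain, and one group element moves base faces onto all of
  it.\<close>

lemma ex_fixer_between:
  assumes H: "H \<in> carrier K" and ab: "a \<in> {-1..int n}" "b \<in> {-1..int n}" "F a \<sqsubseteq> H" "H \<sqsubseteq> F b"
  obtains \<sigma> where "\<sigma> \<in> fixer {a+1..b-1}" "\<sigma> (F (face_rank K H)) = H"
proof -
  let ?L = "F ` {-1..a}" and ?U = "F ` {b..int n}"
  have lo: "x \<sqsubseteq> H" if "x \<in> ?L" for x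
    using that le_trans[of x "F a" H] F_mono F_carrier assms by auto
  have up: "H \<sqsubseteq> y" if "y \<in> ?U" for y
    using that le_trans[of H "F b" y] F_mono F_carrier assms by auto
  have car: "?L \<subseteq> carrier K" "?U \<subseteq> carrier K" using F_carrier ab by auto
  have HU: "poset_chain K ({H} \<union> ?U)"
    using H up ab by (intro poset_chain_Un chain_F) (auto simp: poset_chain_def)
  have "poset_chain K (?L \<union> ({H} \<union> ?U))"
  proof (rule poset_chain_Un)
    show "x \<sqsubseteq> y" if "x \<in> ?L" "y \<in> {H} \<union> ?U" for x y
      using that lo up le_trans[of x H y] car H by blast
  qed (use HU ab in \<open>auto intro: chain_F\<close>)
  then obtain \<sigma> where \<sigma>: "\<sigma> \<in> \<Gamma>"
    "\<forall>x\<in>?L \<union> ({H} \<union> ?U). face_rank K x \<in> {-1..int n} \<and> \<sigma> (F (face_rank K x)) = x"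
    by (rule ex_rep_chain)
  \<comment> \<open>Such a \<open>k\<close> is at most \<open>a\<close> or at least
    \<open>b\<close>, so \<open>F k\<close> belongs to the chain and is the image of the base face
    of its own rank \<open>k\<close>.\<close>
  have "\<sigma> (F k) = F k" if "k \<in> {-1..int n} - {a+1..b-1}" for k
    using \<sigma>(2)[rule_format, of "F k"] that rank_F[of k] by auto
  with \<sigma> show thesis by (intro that[of \<sigma>]) (auto simp: fixer_def)
qed

text \<open>
  Induction on \<open>b - a\<close>: along a path in the section \<open>F\<^sub>b/F\<^sub>a\<close> from \<open>F\<^sub>a\<^sub>+\<^sub>1\<close> to its image, every face is an
  image of a base face under the generated subgroup, because each step takes place in a smaller
  section.
\<close>

lemma fixer_interval_gen:
  assumes "a \<ge> -1" "b \<le> int n"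
  shows "fixer {a+1..b-1} \<subseteq> gen_subgroup G R {a+1..b-1}"
  using assms
proof (induction "nat (b - a)" arbitrary: a b rule: less_induct)
  case less
  let ?\<Delta> = "gen_subgroup G R {a+1..b-1}"
  consider "b \<le> a + 1" | "b = a + 2" | "b \<ge> a + 3" by linarith
  then show ?case
  proof cases
    \<comment> \<open>The open interval of ranks is empty, so the fixer is the stabilizer of the
      base flag.\<close>
    case 1
    then show ?thesis using fixer_empty_gen by simp
  next
    case 2
    \<comment> \<open>The section has rank 1 and its connectedness says nothing, but the fixer is
      itself one of the generating subgroups.\<close>
    then have "fixer {a+1..b-1} = R (a+1)" by (auto simp: fixer_def)
    with 2 R_gen[of "a+1" "{a+1..b-1}"] show ?thesis by simp
  next
    case 3
    have a: "a \<in> {-1..int n}" "a + 1 \<in> {-1..int n}" and b: "b \<in> {-1..int n}" using 3 less.prems by auto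
    note aF = F_carrier[OF a(1)] F_carrier[OF b]
    have IH: "fixer {c+1..d-1} \<subseteq> ?\<Delta>" if "a \<le> c" "d \<le> b" "d - c < b - a" for c d
    proof -
      have "fixer {c+1..d-1} \<subseteq> gen_subgroup G R {c+1..d-1}"
        using less.hyps[of d c] less.prems 3 that by auto
      also have "\<dots> \<subseteq> ?\<Delta>" using that by (intro gen_mono) auto
      finally show ?thesis .
    qed
    show ?thesis
    proof
      fix \<sigma> assume \<sigma>: "\<sigma> \<in> fixer {a+1..b-1}"
      note \<sigma>\<Gamma> = fixer_\<Gamma>[OF \<sigma>]
      have fixab: "\<phi> (F a) = F a" "\<phi> (F b) = F b" if "\<phi> \<in> fixer {a+1..b-1}" for \<phi>
        using fixerD[OF that] a b by auto
      \<comment> \<open>The inverse gives injectivity, which keeps the inequalities strict.\<close>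
      have strict: "F a \<sqsubset> \<phi> x" "\<phi> x \<sqsubset> F b"
        if "\<phi> \<in> fixer {a+1..b-1}" "x \<in> carrier K" "F a \<sqsubset> x" "x \<sqsubset> F b" for \<phi> x
        using that \<Gamma>D(2)[OF fixer_\<Gamma>[OF that(1)]] aF fixab[OF that(1)]
          inv_apply(1)[OF fixer_\<Gamma>[OF that(1)]]
        by (auto simp: lless_iff) metis+
      have F': "F (a+1) \<in> carrier K" "F a \<sqsubset> F (a+1)" "F (a+1) \<sqsubset> F b"
        using F_carrier F_strict_mono a b 3 by auto
      \<comment> \<open>The invariant along the path: each face is the image of the base face of its
        rank under an element of \<open>?\<Delta>\<close>.\<close>
      have "\<exists>\<gamma>\<in>?\<Delta>. \<gamma> (F (face_rank K (\<sigma> (F (a+1))))) = \<sigma> (F (a+1))"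
      proof (rule section_connected_induct[of "F a" "F b" "F (a+1)"])
        show "F a \<sqsubseteq> F b" using F_mono a b 3 by auto
        show "3 \<le> face_rank K (F b) - face_rank K (F a)" using rank_F a b 3 by auto
        show "\<sigma> (F (a+1)) \<in> carrier K \<and> F a \<sqsubset> \<sigma> (F (a+1)) \<and> \<sigma> (F (a+1)) \<sqsubset> F b"
          using strict[OF \<sigma>] F' \<Gamma>D(1)[OF \<sigma>\<Gamma>] by auto
        show "\<exists>\<gamma>\<in>?\<Delta>. \<gamma> (F (face_rank K (F (a+1)))) = F (a+1)"
          using subgroup.one_closed[OF gen_subgroup_subgroup] one_apply F' rank_F[OF a(2)] by auto
      next
        fix x y
        assume x: "x \<in> carrier K" "F a \<sqsubset> x" "x \<sqsubset> F b" and y: "y \<in> carrier K" "F a \<sqsubset> y" "y \<sqsubset> F b"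
          and xy: "x \<sqsubseteq> y \<or> y \<sqsubseteq> x" and "\<exists>\<gamma>\<in>?\<Delta>. \<gamma> (F (face_rank K x)) = x"
        then obtain \<gamma> where \<gamma>: "\<gamma> \<in> ?\<Delta>" "\<gamma> (F (face_rank K x)) = x" by blast
        let ?\<gamma>' = "inv\<^bsub>G\<^esub> \<gamma>" and ?r = "face_rank K x"
        have \<gamma>': "?\<gamma>' \<in> ?\<Delta>" using subgroup.m_inv_closed[OF gen_subgroup_subgroup \<gamma>(1)] .
        note fx = subsetD[OF gen_fixer \<gamma>(1)] and fx' = subsetD[OF gen_fixer \<gamma>']
        note g = fixer_\<Gamma>[OF fx] and g' = fixer_\<Gamma>[OF fx']
        have r: "?r \<in> {-1..int n}" using ex_rep[OF x(1)] by blast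
        have "a < ?r" "?r < b"
          using face_rank_strict_mono[OF _ _ x(2)] face_rank_strict_mono[OF _ _ x(3)] x aF rank_F a b
          by auto
        \<comment> \<open>Undoing \<gamma> turns \<open>x\<close> into the base face
          \<open>F ?r\<close>, so the neighbour \<open>y\<close> becomes a face comparable to a base
          face.\<close>
        let ?z = "?\<gamma>' y"
        have z: "?z \<in> carrier K" "F a \<sqsubseteq> ?z" "?z \<sqsubseteq> F b" "\<gamma> ?z = y"
          using \<Gamma>D(1)[OF g' y(1)] strict[OF fx' y] inv_apply(2)[OF g y(1)]
          by (auto simp: lless_iff)
        have "?\<gamma>' x = F ?r"
          using inv_apply(1)[OF g F_carrier[OF r]] \<gamma>(2) by simp
        then have zr: "F ?r \<sqsubseteq> ?z \<or> ?z \<sqsubseteq> F ?r"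
          using xy \<Gamma>D(2)[OF g' x(1) y(1)] \<Gamma>D(2)[OF g' y(1) x(1)] by metis
        \<comment> \<open>\<open>?z\<close> lies between \<open>F ?r\<close> and \<open>F b\<close>
          or between \<open>F a\<close> and \<open>F ?r\<close>. Both intervals are shorter since
          \<open>a < ?r\<close> and \<open>?r < b\<close>, so the induction hypothesis puts the
          fixer elements found by \<open>ex_fixer_between\<close> into
          \<open>?\<Delta>\<close>.\<close>
        have "\<exists>\<tau>\<in>?\<Delta>. \<tau> (F (face_rank K ?z)) = ?z"
          using zr
        proof
          assume "F ?r \<sqsubseteq> ?z"
          then obtain \<tau> where "\<tau> \<in> fixer {?r+1..b-1}" "\<tau> (F (face_rank K ?z)) = ?z"
            using ex_fixer_between[OF z(1) r b] z by blast
          moreover have "fixer {?r+1..b-1} \<subseteq> ?\<Delta>" using IH[of ?r b] \<open>a < ?r\<close> by simp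
          ultimately show ?thesis by blast
        next
          assume "?z \<sqsubseteq> F ?r"
          then obtain \<tau> where "\<tau> \<in> fixer {a+1..?r-1}" "\<tau> (F (face_rank K ?z)) = ?z"
            using ex_fixer_between[OF z(1) a(1) r] z by blast
          moreover have "fixer {a+1..?r-1} \<subseteq> ?\<Delta>" using IH[of a ?r] \<open>?r < b\<close> by simp
          ultimately show ?thesis by blast
        qed
        then obtain \<tau> where \<tau>: "\<tau> \<in> ?\<Delta>" "\<tau> (F (face_rank K ?z)) = ?z" by blast
        have zy: "face_rank K ?z = face_rank K y" using face_rank_aut[OF \<Gamma>_aut[OF g'] y(1)] .
        have "face_rank K y \<in> {-1..int n}" using ex_rep[OF y(1)] by blast
        then have "(\<tau> \<otimes>\<^bsub>G\<^esub> \<gamma>) (F (face_rank K y)) = y"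
          using mult_apply[OF F_carrier] \<tau>(2) z(4) zy by simp
        with gen_mult[OF \<tau>(1) \<gamma>(1)] show "\<exists>\<gamma>\<in>?\<Delta>. \<gamma> (F (face_rank K y)) = y" by blast
      qed (use aF F' in auto)
      then obtain \<gamma> where \<gamma>: "\<gamma> \<in> ?\<Delta>" "\<gamma> (F (a+1)) = \<sigma> (F (a+1))"
        using rank_image[OF a(2) \<sigma>\<Gamma>] by auto
      note fx = subsetD[OF gen_fixer \<gamma>(1)]
      note g = fixer_\<Gamma>[OF fx]
      \<comment> \<open>As \<gamma> agrees with \<sigma> on \<open>F (a+1)\<close>, this quotient
        fixes that face too and falls under the induction hypothesis with \<open>a+1\<close> in
        place of \<open>a\<close>.\<close>
      let ?\<tau> = "\<sigma> \<otimes>\<^bsub>G\<^esub> inv\<^bsub>G\<^esub> \<gamma>"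
      have "?\<tau> \<in> fixer {a+1+1..b-1}"
        unfolding fixer_def
      proof safe
        show "?\<tau> \<in> \<Gamma>" using mult_closed inv_closed \<sigma>\<Gamma> g by blast
        fix k assume k: "k \<in> {-1..int n}" "k \<notin> {a+1+1..b-1}"
        have "\<sigma> (F k) = \<gamma> (F k)"
        proof (cases "k = a + 1")
          case False
          then have "k \<notin> {a+1..b-1}" using k by auto
          then show ?thesis using fixerD[OF \<sigma> k(1)] fixerD[OF fx k(1)] by simp
        qed (simp add: \<gamma>)
        then show "?\<tau> (F k) = F k"
          using mult_apply inv_apply(1)[OF g] F_carrier[OF k(1)] by simp
      qed
      then have "?\<tau> \<in> ?\<Delta>" using IH[of "a+1" b] by auto
      from gen_mult[OF this \<gamma>(1)] show "\<sigma> \<in> ?\<Delta>"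
        using mult_inv_cancel[OF \<sigma>\<Gamma> g] by simp
    qed
  qed
qed

text \<open>Freeing rank \<open>int n\<close> adds nothing, because all of \<Gamma> fixes
  \<open>F (int n)\<close>; the interval lemma with \<open>b = int n\<close> then applies.\<close>

lemma fixer_upper_gen:
  assumes "i \<in> {-1..int n}" shows "fixer {i+1..int n} \<subseteq> gen_plus n G R (i+1)"
proof -
  have "fixer {i+1..int n} \<subseteq> fixer {i+1..int n - 1}"
  proof
    fix \<phi> assume \<phi>: "\<phi> \<in> fixer {i+1..int n}"
    have "\<phi> (F k) = F k" if "k \<in> {-1..int n} - {i+1..int n - 1}" for k
      using fixerD[OF \<phi>, of k] improper_fixed(2)[OF fixer_\<Gamma>[OF \<phi>]] that by (cases "k = int n") auto
    with fixer_\<Gamma>[OF \<phi>] show "\<phi> \<in> fixer {i+1..int n - 1}" by (auto simp: fixer_def)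
  qed
  also have "\<dots> \<subseteq> gen_subgroup G R {i+1..int n - 1}"
    using assms by (intro fixer_interval_gen) auto
  also have "\<dots> \<subseteq> gen_plus n G R (i+1)" by (intro gen_mono) auto
  finally show ?thesis .
qed

lemma fixer_lower_gen:
  assumes "j \<in> {-1..int n}" shows "fixer {-1..j-1} \<subseteq> gen_minus G R (j-1)"
proof -
  \<comment> \<open>Dually, freeing rank \<open>-1\<close> adds nothing. The bound
    \<open>-1+1\<close> matches the interval lemma with \<open>a = -1\<close>.\<close>
  have "fixer {-1..j-1} \<subseteq> fixer {-1+1..j-1}"
  proof
    fix \<phi> assume \<phi>: "\<phi> \<in> fixer {-1..j-1}"
    have "\<phi> (F k) = F k" if "k \<in> {-1..int n} - {-1+1..j-1}" for k
      using fixerD[OF \<phi>, of k] improper_fixed(1)[OF fixer_\<Gamma>[OF \<phi>]] that by (cases "k = -1") auto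
    with fixer_\<Gamma>[OF \<phi>] show "\<phi> \<in> fixer {-1+1..j-1}" by (auto simp: fixer_def)
  qed
  also have "\<dots> \<subseteq> gen_subgroup G R {-1+1..j-1}"
    using assms by (intro fixer_interval_gen) auto
  also have "\<dots> \<subseteq> gen_minus G R (j-1)" by (intro gen_mono) auto
  finally show ?thesis .
qed

section \<open>The coset order in terms of faces\<close>

lemma le_base_iff:
  assumes i: "i \<in> {-1..int n}" and j: "j \<in> {-1..int n}" and "i \<le> j" and \<tau>: "\<tau> \<in> \<Gamma>"
  shows "\<tau> (F i) \<sqsubseteq> F j \<longleftrightarrow> \<tau> \<in> gen_plus n G R (i+1) <#>\<^bsub>G\<^esub> gen_minus G R (j-1)"
proof
  assume le: "\<tau> (F i) \<sqsubseteq> F j"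
  let ?L = "\<tau> ` F ` {-1..i}" and ?U = "F ` {j..int n}"
  have "poset_chain K (?L \<union> ?U)"
  proof (rule poset_chain_Un)
    show "poset_chain K ?L" using poset_chain_aut_image[OF \<Gamma>_aut[OF \<tau>] chain_F] i by simp
    show "poset_chain K ?U" using chain_F j by simp
    fix x y assume "x \<in> ?L" "y \<in> ?U"
    then obtain k l where k: "k \<in> {-1..i}" "x = \<tau> (F k)" and l: "l \<in> {j..int n}" "y = F l" by blast
    have kl: "k \<in> {-1..int n}" "l \<in> {-1..int n}" using k l i j by auto
    have "\<tau> (F k) \<sqsubseteq> \<tau> (F i)" using \<Gamma>D(2)[OF \<tau>] F_mono[of k i] F_carrier kl i k by auto
    then have "\<tau> (F k) \<sqsubseteq> F j"
      using le le_trans[of "\<tau> (F k)" "\<tau> (F i)" "F j"] \<Gamma>D(1)[OF \<tau>] F_carrier kl i j by auto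
    moreover have "F j \<sqsubseteq> F l" using F_mono kl l j by auto
    ultimately show "x \<sqsubseteq> y"
      using le_trans[of "\<tau> (F k)" "F j" "F l"] \<Gamma>D(1)[OF \<tau>] F_carrier kl j k l by auto
  qed
  then obtain \<sigma> where \<sigma>: "\<sigma> \<in> \<Gamma>"
    "\<forall>x\<in>?L \<union> ?U. face_rank K x \<in> {-1..int n} \<and> \<sigma> (F (face_rank K x)) = x"
    by (rule ex_rep_chain)
  \<comment> \<open>For \<open>k \<ge> j\<close> the face \<open>F k\<close> is in the chain, so
    \<sigma> fixes it.\<close>
  have "\<sigma> (F k) = F k" if "k \<in> {-1..int n} - {-1..j-1}" for k
    using \<sigma>(2)[rule_format, of "F k"] that rank_F[of k] by auto
  then have 1: "\<sigma> \<in> gen_minus G R (j-1)"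
    using fixer_lower_gen[OF j] \<sigma>(1) by (auto simp: fixer_def)
  \<comment> \<open>For \<open>k \<le> i\<close> the chain contains \<open>\<tau> (F k)\<close>, so
    \<sigma> and \<tau> agree on \<open>F k\<close>.\<close>
  have "(\<tau> \<otimes>\<^bsub>G\<^esub> inv\<^bsub>G\<^esub> \<sigma>) (F k) = F k" if k: "k \<in> {-1..int n} - {i+1..int n}" for k
  proof -
    have "\<sigma> (F k) = \<tau> (F k)"
      using \<sigma>(2)[rule_format, of "\<tau> (F k)"] k rank_image[OF _ \<tau>, of k] by auto
    then show ?thesis using mult_apply inv_apply(1)[OF \<sigma>(1)] F_carrier k by (metis DiffD1)
  qed
  then have 2: "\<tau> \<otimes>\<^bsub>G\<^esub> inv\<^bsub>G\<^esub> \<sigma> \<in> gen_plus n G R (i+1)"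
    using fixer_upper_gen[OF i] mult_closed[OF \<tau> inv_closed[OF \<sigma>(1)]] by (auto simp: fixer_def)
  show "\<tau> \<in> gen_plus n G R (i+1) <#>\<^bsub>G\<^esub> gen_minus G R (j-1)"
    using 1 2 mult_inv_cancel[OF \<tau> \<sigma>(1), symmetric] unfolding set_mult_def by blast
next
  assume "\<tau> \<in> gen_plus n G R (i+1) <#>\<^bsub>G\<^esub> gen_minus G R (j-1)"
  then obtain \<alpha> \<beta> where ab: "\<alpha> \<in> gen_plus n G R (i+1)" "\<beta> \<in> gen_minus G R (j-1)" "\<tau> = \<alpha> \<otimes>\<^bsub>G\<^esub> \<beta>"
    unfolding set_mult_def by blast
  note f = subsetD[OF gen_fixer ab(1)] subsetD[OF gen_fixer ab(2)]
  \<comment> \<open>Products apply the left factor first: \<alpha> leaves \<open>F i\<close> in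
    place, and \<beta> then sends it below \<open>\<beta> (F j)\<close>, which is
    \<open>F j\<close>.\<close>
  have "\<alpha> (F i) = F i" "\<beta> (F j) = F j" using fixerD[OF f(1) i] fixerD[OF f(2) j] by auto
  moreover have "\<beta> (F i) \<sqsubseteq> \<beta> (F j)"
    using \<Gamma>D(2)[OF fixer_\<Gamma>[OF f(2)]] F_carrier F_mono assms by auto
  ultimately show "\<tau> (F i) \<sqsubseteq> F j" using ab(3) mult_apply[OF F_carrier[OF i]] by simp
qed

text \<open>Applying the inverse of \<psi> to both faces reduces the comparison to one with the base
  face \<open>F j\<close>; \<open>i \<le> j\<close> follows from ranks.\<close>

lemma coset_le_iff:
  assumes i: "i \<in> {-1..int n}" and j: "j \<in> {-1..int n}" and \<phi>: "\<phi> \<in> \<Gamma>" and \<psi>: "\<psi> \<in> \<Gamma>"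
  shows "coset_le n G R i \<phi> j \<psi> \<longleftrightarrow> \<phi> (F i) \<sqsubseteq> \<psi> (F j)"
proof -
  let ?\<tau> = "\<phi> \<otimes>\<^bsub>G\<^esub> inv\<^bsub>G\<^esub> \<psi>"
  have \<tau>: "?\<tau> \<in> \<Gamma>" using mult_closed inv_closed \<phi> \<psi> by blast
  have "\<phi> (F i) = \<psi> (?\<tau> (F i))"
    using mult_inv_cancel[OF \<phi> \<psi>] mult_apply[OF F_carrier[OF i]] by metis
  then have eq: "\<phi> (F i) \<sqsubseteq> \<psi> (F j) \<longleftrightarrow> ?\<tau> (F i) \<sqsubseteq> F j"
    using \<Gamma>D(2)[OF \<psi>] \<Gamma>D(1)[OF \<tau>] F_carrier i j by auto
  have "i \<le> j" if "\<phi> (F i) \<sqsubseteq> \<psi> (F j)"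
    using face_rank_mono[OF _ _ that] rank_image \<Gamma>D(1) F_carrier assms by auto
  then show ?thesis
    unfolding coset_le_def using eq le_base_iff[OF i j _ \<tau>] by blast
qed

section \<open>Face stabilizers and cosets\<close>

text \<open>Fixing \<open>F i\<close> entails a comparison of its image with \<open>F i\<close>, so
  \<open>le_base_iff\<close> factors \<tau>. The index ranges of both factors omit
  \<open>i\<close>.\<close>

lemma stabilizer_gen:
  assumes "0 \<le> i" "i \<le> int n - 1"
  shows "\<tau> \<in> gen_subgroup G R ({-1..int n} - {i}) \<longleftrightarrow> \<tau> \<in> \<Gamma> \<and> \<tau> (F i) = F i"
proof
  assume "\<tau> \<in> gen_subgroup G R ({-1..int n} - {i})"
  then have "\<tau> \<in> fixer ({-1..int n} - {i})" using gen_fixer by blast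
  then show "\<tau> \<in> \<Gamma> \<and> \<tau> (F i) = F i" using fixerD[of \<tau> _ i] fixer_\<Gamma> assms by auto
next
  have i: "i \<in> {-1..int n}" using assms by auto
  assume \<tau>: "\<tau> \<in> \<Gamma> \<and> \<tau> (F i) = F i"
  then have "\<tau> (F i) \<sqsubseteq> F i" using F_carrier[OF i] by simp
  with \<tau> have "\<tau> \<in> gen_plus n G R (i+1) <#>\<^bsub>G\<^esub> gen_minus G R (i-1)"
    by (intro iffD1[OF le_base_iff[OF i i order_refl]]) simp_all
  then obtain \<alpha> \<beta> where ab: "\<alpha> \<in> gen_plus n G R (i+1)" "\<beta> \<in> gen_minus G R (i-1)" "\<tau> = \<alpha> \<otimes>\<^bsub>G\<^esub> \<beta>"
    unfolding set_mult_def by blast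
  have "gen_plus n G R (i+1) \<subseteq> gen_subgroup G R ({-1..int n} - {i})"
    "gen_minus G R (i-1) \<subseteq> gen_subgroup G R ({-1..int n} - {i})"
    using assms by (auto intro!: gen_mono)
  then show "\<tau> \<in> gen_subgroup G R ({-1..int n} - {i})"
    using ab gen_mult by blast
qed

text \<open>Well-definedness and injectivity of the isomorphism in one: cosets of a stabilizer
  correspond to points of the orbit, and the rank component separates different ranks.\<close>

lemma coset_face_eq_iff:
  assumes i: "i \<in> {-1..int n}" and j: "j \<in> {-1..int n}" and \<phi>: "\<phi> \<in> \<Gamma>" and \<psi>: "\<psi> \<in> \<Gamma>"
  shows "coset_face n G R i \<phi> = coset_face n G R j \<psi> \<longleftrightarrow> \<phi> (F i) = \<psi> (F j)"
proof (cases "i = j")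
  case False
  then have "\<phi> (F i) \<noteq> \<psi> (F j)" using rank_image[OF i \<phi>] rank_image[OF j \<psi>] by auto
  with False show ?thesis by (simp add: coset_face_def)
next
  case True
  show ?thesis
  proof (cases "0 \<le> i \<and> i \<le> int n - 1")
    case False
    \<comment> \<open>At an improper rank there is a single coset face, and \<Gamma> fixes the base
      face.\<close>
    then have "i = -1 \<or> i = int n" using i by auto
    then have "\<phi> (F i) = \<psi> (F i)" using improper_fixed[OF \<phi>] improper_fixed[OF \<psi>] by auto
    with False True show ?thesis by (auto simp: coset_face_def)
  next
    case inner: True
    let ?S = "gen_subgroup G R ({-1..int n} - {i})"
    let ?\<tau> = "\<phi> \<otimes>\<^bsub>G\<^esub> inv\<^bsub>G\<^esub> \<psi>"
    note S = gen_subgroup_subgroup[of "{-1..int n} - {i}"]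
    have \<tau>: "?\<tau> \<in> \<Gamma>" using mult_closed inv_closed \<phi> \<psi> by blast
    have "?S #>\<^bsub>G\<^esub> \<phi> = ?S #>\<^bsub>G\<^esub> \<psi> \<longleftrightarrow> ?\<tau> \<in> ?S"
    proof
      assume "?S #>\<^bsub>G\<^esub> \<phi> = ?S #>\<^bsub>G\<^esub> \<psi>"
      then have "\<phi> \<in> ?S #>\<^bsub>G\<^esub> \<psi>" using G.rcos_self[OF _ S, of \<phi>] \<phi> by simp
      then show "?\<tau> \<in> ?S" using subgroup.rcos_module_imp[OF S G.is_group, of \<psi> \<phi>] \<psi> by simp
    next
      assume "?\<tau> \<in> ?S"
      then have "\<phi> \<in> ?S #>\<^bsub>G\<^esub> \<psi>"
        using subgroup.rcos_module_rev[OF S G.is_group, of \<psi> \<phi>] \<phi> \<psi> by simp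
      then show "?S #>\<^bsub>G\<^esub> \<phi> = ?S #>\<^bsub>G\<^esub> \<psi>" using G.repr_independence[OF _ _ S, of \<phi> \<psi>] \<psi> by simp
    qed
    also have "\<dots> \<longleftrightarrow> ?\<tau> (F i) = F i" using stabilizer_gen inner \<tau> by blast
    also have "\<dots> \<longleftrightarrow> \<phi> (F i) = \<psi> (F i)"
      using mult_apply[OF F_carrier[OF i], of \<phi> "inv\<^bsub>G\<^esub> \<psi>"] inv_apply[OF \<psi>] \<Gamma>D(1)[OF \<phi>] F_carrier[OF i]
      by metis
    finally show ?thesis using inner True by (auto simp: coset_face_def)
  qed
qed

section \<open>The coset complex and the isomorphism\<close>

text \<open>Another choice of ranks and representatives for the same coset faces gives the same
  faces of \<open>K\<close>, and \<open>coset_le\<close> depends only on these.\<close>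

lemma coset_complex_le_iff:
  assumes "i \<in> {-1..int n}" "j \<in> {-1..int n}" "\<phi> \<in> \<Gamma>" "\<psi> \<in> \<Gamma>"
  shows "coset_face n G R i \<phi> \<sqsubseteq>\<^bsub>coset_complex n G R\<^esub> coset_face n G R j \<psi>
    \<longleftrightarrow> coset_le n G R i \<phi> j \<psi>"
proof
  assume "coset_face n G R i \<phi> \<sqsubseteq>\<^bsub>coset_complex n G R\<^esub> coset_face n G R j \<psi>"
  then obtain k l \<alpha> \<beta> where kl: "k \<in> {-1..int n}" "l \<in> {-1..int n}" "\<alpha> \<in> \<Gamma>" "\<beta> \<in> \<Gamma>"
    and eq: "coset_face n G R i \<phi> = coset_face n G R k \<alpha>" "coset_face n G R j \<psi> = coset_face n G R l \<beta>"
    and le: "coset_le n G R k \<alpha> l \<beta>"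
    unfolding coset_complex_def by auto
  have "\<phi> (F i) = \<alpha> (F k)" "\<psi> (F j) = \<beta> (F l)"
    using eq coset_face_eq_iff kl assms by blast+
  with le show "coset_le n G R i \<phi> j \<psi>"
    using coset_le_iff[OF kl] coset_le_iff[OF assms] by simp
next
  assume "coset_le n G R i \<phi> j \<psi>"
  then show "coset_face n G R i \<phi> \<sqsubseteq>\<^bsub>coset_complex n G R\<^esub> coset_face n G R j \<psi>"
    using assms by (simp add: coset_complex_def del: atLeastAtMost_iff) blast
qed

text \<open>The map chooses a group element carrying a base face to \<open>x\<close>; by
  \<open>coset_face_eq_iff\<close> the resulting coset is independent of the choice.\<close>

lemma ex_coset_complex_iso:
  "\<exists>f \<in> poset_iso K (coset_complex n G R).
     \<forall>i\<in>{-1..int n}. \<forall>\<phi>\<in>\<Gamma>. f (\<phi> (F i)) = coset_face n G R i \<phi>"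
proof -
  define rep where "rep x = (SOME \<sigma>. \<sigma> \<in> \<Gamma> \<and> \<sigma> (F (face_rank K x)) = x)" for x
  define f where "f x = coset_face n G R (face_rank K x) (rep x)" for x
  have rep: "rep x \<in> \<Gamma>" "rep x (F (face_rank K x)) = x" "face_rank K x \<in> {-1..int n}"
    if x: "x \<in> carrier K" for x
  proof -
    obtain \<sigma> where "\<sigma> \<in> \<Gamma>" "face_rank K x \<in> {-1..int n}" "\<sigma> (F (face_rank K x)) = x"
      using ex_rep[OF x] .
    then show "rep x \<in> \<Gamma>" "rep x (F (face_rank K x)) = x" "face_rank K x \<in> {-1..int n}"
      using someI[of "\<lambda>\<sigma>. \<sigma> \<in> \<Gamma> \<and> \<sigma> (F (face_rank K x)) = x" \<sigma>] unfolding rep_def by auto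
  qed
  have f: "f (\<phi> (F i)) = coset_face n G R i \<phi>" if "i \<in> {-1..int n}" "\<phi> \<in> \<Gamma>" for i \<phi>
  proof -
    have x: "\<phi> (F i) \<in> carrier K" using \<Gamma>D(1) F_carrier that by blast
    show ?thesis unfolding f_def using coset_face_eq_iff[OF rep(3)[OF x] that(1) rep(1)[OF x] that(2)] rep(2)[OF x]
      by simp
  qed
  have "bij_betw f (carrier K) (carrier (coset_complex n G R))"
    unfolding bij_betw_def
  proof
    show "inj_on f (carrier K)"
    proof (rule inj_onI)
      fix x y assume x: "x \<in> carrier K" and y: "y \<in> carrier K" and "f x = f y"
      then have "rep x (F (face_rank K x)) = rep y (F (face_rank K y))"
        unfolding f_def
        using coset_face_eq_iff[OF rep(3)[OF x] rep(3)[OF y] rep(1)[OF x] rep(1)[OF y]] by blast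
      then show "x = y" by (simp only: rep(2)[OF x] rep(2)[OF y])
    qed
    show "f ` carrier K = carrier (coset_complex n G R)"
    proof
      show "f ` carrier K \<subseteq> carrier (coset_complex n G R)"
      proof
        fix X assume "X \<in> f ` carrier K"
        then obtain x where x: "x \<in> carrier K" "X = f x" by blast
        then show "X \<in> carrier (coset_complex n G R)"
          using rep(1,3)[OF x(1)] unfolding f_def coset_complex_def by auto
      qed
      show "carrier (coset_complex n G R) \<subseteq> f ` carrier K"
      proof
        fix X assume "X \<in> carrier (coset_complex n G R)"
        then obtain i \<phi> where X: "X = coset_face n G R i \<phi>" "i \<in> {-1..int n}" "\<phi> \<in> \<Gamma>"
          unfolding coset_complex_def by auto
        then have "X = f (\<phi> (F i))" "\<phi> (F i) \<in> carrier K"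
          using f[of i \<phi>] \<Gamma>D(1) F_carrier by auto
        then show "X \<in> f ` carrier K" by blast
      qed
    qed
  qed
  moreover have "x \<sqsubseteq> y \<longleftrightarrow> f x \<sqsubseteq>\<^bsub>coset_complex n G R\<^esub> f y"
    if x: "x \<in> carrier K" and y: "y \<in> carrier K" for x y
    using coset_complex_le_iff[OF rep(3)[OF x] rep(3)[OF y] rep(1)[OF x] rep(1)[OF y]]
      coset_le_iff[OF rep(3)[OF x] rep(3)[OF y] rep(1)[OF x] rep(1)[OF y]]
    unfolding f_def rep(2)[OF x] rep(2)[OF y] by blast
  ultimately show ?thesis using f unfolding poset_iso_def by blast
qed

end

text \<open>The second conjunct secures the meaning of the first: the order of the coset complex,
  declared through some representatives, can be tested on any.\<close>

theorem theorem4p4: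
  fixes n :: nat
    and K :: "'a gorder"
    and \<Gamma> :: "('a \<Rightarrow> 'a) set"
    and F :: "int \<Rightarrow> 'a"
    and G :: "('a \<Rightarrow> 'a) monoid"
    and R :: "int \<Rightarrow> ('a \<Rightarrow> 'a) set"
  assumes "n \<ge> 1"
    and "regular_incidence_complex n K"
    and "subgroup \<Gamma> (aut_group K)"
    and "flag_transitive \<Gamma> K"
    and "flag K (F ` {-1..int n})"
    and "\<And>i. i \<in> {-1..int n} \<Longrightarrow> face_rank K (F i) = i"
  defines "G \<equiv> (aut_group K)\<lparr>carrier := \<Gamma>\<rparr>"
    and "R \<equiv> (\<lambda>i. {\<phi> \<in> \<Gamma>. \<forall>j\<in>{-1..int n}. j \<noteq> i \<longrightarrow> \<phi> (F j) = F j})"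
  shows "(\<exists>f \<in> poset_iso K (coset_complex n G R).
            \<forall>i\<in>{-1..int n}. \<forall>\<phi>\<in>\<Gamma>. f (\<phi> (F i)) = coset_face n G R i \<phi>)
    \<and> (\<forall>i\<in>{-1..int n}. \<forall>j\<in>{-1..int n}. \<forall>\<phi>\<in>\<Gamma>. \<forall>\<psi>\<in>\<Gamma>.
          coset_face n G R i \<phi> \<sqsubseteq>\<^bsub>coset_complex n G R\<^esub> coset_face n G R j \<psi>
            \<longleftrightarrow> coset_le n G R i \<phi> j \<psi>)"
proof -
  interpret K: regular_incidence_complex n K by fact
  interpret flag_transitive_complex n K \<Gamma> F
    by (intro flag_transitive_complex.intro flag_transitive_complex_axioms.intro
        K.incidence_complex_axioms assms(3-6))
  show ?thesis
    unfolding G_def R_def using ex_coset_complex_iso coset_complex_le_iff by blast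
qed

end
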